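(* Let $0\le z\le n$ and let $\mu$ be a partition of $n-z$. Then $$V\big(I_{(\mu,z)}\big)=\{x\in K^n: z(x)>z\}\ \cup\ \{x\in K^n: z(x)=z,\ \mu(x)\not\trianglelefteq\mu\}.$$
   Context: Standing assumptions: $r\ge 2$, and $K$ is an infinite field containing all $r$-th roots of unity (e.g. algebraically closed). For an ideal $J\subset K[x_1,\dots,x_n]$, $V(J)\subset K^n$ is its set of common zeros in $K^n$. Orbit type: for $x\in K^n$, $z(x)$ is the number of indices $i$ with $x_i=0$, and $\mu(x)$ is the partition of $n-z(x)$ recording the multiplicities of the repeated values among the $r$-th powers $x_i^r$ of the nonzero coordinates. Dominance order: for partitions $\lambda,\nu$ of the same integer, $\lambda\trianglelefteq\nu$ means $\lambda_1+\dots+\lambda_i\le\nu_1+\dots+\nu_i$ for all $i$; $\not\trianglelefteq$ is its negation. Classical Specht ideal: for a partition $\mu\vdash N$, $I_\mu\subset K[y_1,\dots,y_N]$ is the ideal generated by the Specht polynomials of all tableaux $T$ of shape $\mu$ (bijective fillings with $1,\dots,N$); the Specht polynomial of $T$ is the product over the columns of $T$ of the Vandermonde products $\prod(y_a-y_b)$ over pairs of entries $a,b$ in that column (one factor for each pair; empty products equal $1$). Definition of $I_{(\mu,z)}$: let $0\le z\le n$ and $\mu\vdash n-z$. For $S=\{i_1<\dots<i_{n-z}\}\subset\{1,\dots,n\}$, let $\phi_S:K[y_1,\dots,y_{n-z}]\to K[x_{i_1},\dots,x_{i_{n-z}}]$ be the $K$-algebra homomorphism $y_j\mapsto x_{i_j}^r$,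 and let $X_S=(x_j:j\notin S)\subset K[x_1,\dots,x_n]$. Let $I_{\ge z+1}$ be the ideal of $K[x_1,\dots,x_n]$ generated by all squarefree monomials of degree $n-z$. Then $$I_{(\mu,z)}:=\Big[\bigcap_{S\subset\{1,\dots,n\},\,|S|=n-z}\big(X_S+\phi_S(I_\mu)\big)\Big]\cap I_{\ge z+1},$$ where $X_S+\phi_S(I_\mu)$ denotes the ideal of $K[x_1,\dots,x_n]$ generated by $X_S$ and $\phi_S(I_\mu)$. *)

theory Defs
  imports
    "HOL-Library.Poly_Mapping"
    "HOL-Library.FuncSet"
    "HOL-Algebra.Ideal"
    "HOL-Algebra.Algebraic_Closure_Type"
begin

section \<open>Polynomial rings\<close>

type_synonym 'a mpoly = "(nat \<Rightarrow>\<^sub>0 nat) \<Rightarrow>\<^sub>0 'a"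

definition Const :: "'a::zero \<Rightarrow> 'a mpoly" where
  "Const c = Poly_Mapping.single 0 c"

definition Var :: "nat \<Rightarrow> 'a::zero_neq_one mpoly" where
  "Var i = Poly_Mapping.single (Poly_Mapping.single i 1) 1"

text \<open>
  The type \<^typ>\<open>'a mpoly\<close> has one variable for every natural number. The ring
  \<open>K[x\<^sub>1, \<dots>, x\<^sub>n]\<close> is its subring \<open>mpoly_ring {1..n}\<close>, and ideals of
  \<open>K[x\<^sub>1, \<dots>, x\<^sub>n]\<close> are ideals of this ring.
\<close>

definition mpoly_ring :: "nat set \<Rightarrow> 'a::comm_ring_1 mpoly ring" where
  "mpoly_ring V =
     \<lparr>carrier = {p. \<forall>m\<in>Poly_Mapping.keys p. Poly_Mapping.keys m \<subseteq> V}, monoid.mult = (*), one = 1, zero = 0, add = (+)\<rparr>"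

text \<open>Apply \<open>h\<close> to the coefficients of \<open>p\<close> and replace the variable \<open>i\<close> by \<open>f i\<close>.\<close>

definition insertion :: "('a::zero \<Rightarrow> 'b::comm_semiring_1) \<Rightarrow> (nat \<Rightarrow> 'b) \<Rightarrow> 'a mpoly \<Rightarrow> 'b" where
  "insertion h f p = (\<Sum>m\<in>Poly_Mapping.keys p. h (Poly_Mapping.lookup p m) * (\<Prod>i\<in>Poly_Mapping.keys m. f i ^ Poly_Mapping.lookup m i))"

lemma cring_mpoly_ring: "cring (mpoly_ring V :: 'a::comm_ring_1 mpoly ring)"
proof -
  define C where "C = {p :: 'a mpoly. \<forall>m\<in>Poly_Mapping.keys p. Poly_Mapping.keys m \<subseteq> V}"
  have mult: "p * q \<in> C" if "p \<in> C" "q \<in> C" for p q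
  proof -
    have "Poly_Mapping.keys m \<subseteq> V" if m: "m \<in> Poly_Mapping.keys (p * q)" for m
    proof -
      from m Poly_Mapping.keys_mult[of p q] obtain a b
        where "a \<in> Poly_Mapping.keys p" "b \<in> Poly_Mapping.keys q" "m = a + b" by blast
      with \<open>p \<in> C\<close> \<open>q \<in> C\<close> show ?thesis
        unfolding C_def using Poly_Mapping.keys_add[of a b] by blast
    qed
    thus ?thesis by (simp add: C_def)
  qed
  have add: "p + q \<in> C" if "p \<in> C" "q \<in> C" for p q
    using that Poly_Mapping.keys_add[of p q] unfolding C_def by blast
  have uminus: "- p \<in> C" if "p \<in> C" for p
    using that by (simp add: C_def)
  have C01: "0 \<in> C" "1 \<in> C" by (simp_all add: C_def)
  have R: "mpoly_ring V = \<lparr>carrier = C, monoid.mult = (*), one = 1, zero = 0, add = (+)\<rparr>"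
    by (simp add: mpoly_ring_def C_def)
  show ?thesis
    unfolding R
  proof (intro cringI abelian_groupI comm_monoidI, goal_cases)
    case (6 x)
    thus ?case using uminus[of x] by (auto intro!: bexI[of _ "- x"])
  qed (simp_all add: C01 mult add algebra_simps)
qed

lemma insertion_Const [simp]: "h 0 = 0 \<Longrightarrow> insertion h f (Const c) = h c"
  by (simp add: insertion_def Const_def)

lemma insertion_Var [simp]: "h 1 = 1 \<Longrightarrow> insertion h f (Var i) = f i"
  by (simp add: insertion_def Var_def)

lemma insertion_superset:
  assumes "h 0 = 0" "finite A" "Poly_Mapping.keys p \<subseteq> A"
  shows "insertion h f p = (\<Sum>m\<in>A. h (Poly_Mapping.lookup p m) * (\<Prod>i\<in>Poly_Mapping.keys m. f i ^ Poly_Mapping.lookup m i))"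
  unfolding insertion_def using assms
  by (intro sum.mono_neutral_left) (auto simp: in_keys_iff)

lemma insertion_add:
  assumes "h 0 = 0" "\<And>a b. h (a + b) = h a + h b"
  shows "insertion h f (p + q) = insertion h f p + insertion h f q"
proof -
  let ?A = "Poly_Mapping.keys p \<union> Poly_Mapping.keys q"
  have "insertion h f s = (\<Sum>m\<in>?A. h (Poly_Mapping.lookup s m) * (\<Prod>i\<in>Poly_Mapping.keys m. f i ^ Poly_Mapping.lookup m i))"
    if "s \<in> {p, q, p + q}" for s
    using that Poly_Mapping.keys_add[of p q] by (intro insertion_superset assms) auto
  thus ?thesis
    by (simp add: assms lookup_add distrib_right sum.distrib)
qed

lemma insertion_mult:
  fixes h :: "'a::comm_semiring_1 \<Rightarrow> 'b::comm_semiring_1"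
  assumes h: "h 0 = 0" "\<And>a b. h (a + b) = h a + h b" "\<And>a b. h (a * b) = h a * h b"
  shows "insertion h f (p * q) = insertion h f p * insertion h f q"
proof -
  have mon: "(\<Prod>i\<in>Poly_Mapping.keys (a + b). f i ^ Poly_Mapping.lookup (a + b) i) =
      (\<Prod>i\<in>Poly_Mapping.keys a. f i ^ Poly_Mapping.lookup a i) * (\<Prod>i\<in>Poly_Mapping.keys b. f i ^ Poly_Mapping.lookup b i)"
    for a b :: "nat \<Rightarrow>\<^sub>0 nat"
  proof -
    have *: "(\<Prod>i\<in>Poly_Mapping.keys c. f i ^ Poly_Mapping.lookup c i) = (\<Prod>i\<in>Poly_Mapping.keys a \<union> Poly_Mapping.keys b. f i ^ Poly_Mapping.lookup c i)"
      if "c \<in> {a, b, a + b}" for c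
      using that Poly_Mapping.keys_add[of a b]
      by (intro prod.mono_neutral_left) (auto simp: in_keys_iff)
    show ?thesis
      unfolding *[of a, simplified] *[of b, simplified] *[of "a + b", simplified]
      by (simp add: lookup_add power_add prod.distrib)
  qed
  have single: "insertion h f (Poly_Mapping.single m c) = h c * (\<Prod>i\<in>Poly_Mapping.keys m. f i ^ Poly_Mapping.lookup m i)"
    for m c by (simp add: insertion_def h)
  have zero: "insertion h f 0 = 0" by (simp add: insertion_def)
  have expand: "s = (\<Sum>m\<in>Poly_Mapping.keys s. Poly_Mapping.single m (Poly_Mapping.lookup s m))" for s :: "'a mpoly"
    by (rule poly_mapping_eqI)
      (auto simp: lookup_sum lookup_single when_def in_keys_iff if_distrib sum.delta' cong: if_cong)
  have ssum: "insertion h f (sum g A) = (\<Sum>a\<in>A. insertion h f (g a))"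
    for g :: "(nat \<Rightarrow>\<^sub>0 nat) \<times> (nat \<Rightarrow>\<^sub>0 nat) \<Rightarrow> 'a mpoly" and A
    by (induction A rule: infinite_finite_induct) (auto simp: zero insertion_add h)
  have "p * q = (\<Sum>(a, b)\<in>Poly_Mapping.keys p \<times> Poly_Mapping.keys q. Poly_Mapping.single (a + b) (Poly_Mapping.lookup p a * Poly_Mapping.lookup q b))"
    by (subst expand[of p], subst expand[of q])
      (simp add: sum_product sum.cartesian_product mult_single)
  hence "insertion h f (p * q) =
      (\<Sum>(a, b)\<in>Poly_Mapping.keys p \<times> Poly_Mapping.keys q. insertion h f (Poly_Mapping.single (a + b) (Poly_Mapping.lookup p a * Poly_Mapping.lookup q b)))"
    by (simp add: ssum case_prod_unfold)
  also have "\<dots> = insertion h f p * insertion h f q"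
    unfolding single mon h insertion_def[of h f p] insertion_def[of h f q]
    by (simp add: sum_product sum.cartesian_product algebra_simps)
  finally show ?thesis .
qed

definition affine_space :: "nat \<Rightarrow> (nat \<Rightarrow> 'a) set" where
  "affine_space n = {1..n} \<rightarrow>\<^sub>E UNIV"

definition zero_locus :: "nat \<Rightarrow> 'a::comm_ring_1 mpoly set \<Rightarrow> (nat \<Rightarrow> 'a) set" where
  "zero_locus n J = {x \<in> affine_space n. \<forall>p\<in>J. insertion id x p = 0}"


section \<open>Partitions and orbit types\<close>

definition is_partition :: "nat \<Rightarrow> nat list \<Rightarrow> bool" where
  "is_partition N \<mu> \<longleftrightarrow> sorted_wrt (\<ge>) \<mu> \<and> 0 \<notin> set \<mu> \<and> sum_list \<mu> = N"

text \<open>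
  Since \<open>take\<close> stops at the end of the list, this compares partitions as if
  they were padded with zeros.
\<close>

definition dominated :: "nat list \<Rightarrow> nat list \<Rightarrow> bool" (infix \<open>\<unlhd>\<^sub>d\<close> 50) where
  "\<kappa> \<unlhd>\<^sub>d \<nu> \<longleftrightarrow> (\<forall>i. sum_list (take i \<kappa>) \<le> sum_list (take i \<nu>))"

definition num_zeros :: "nat \<Rightarrow> (nat \<Rightarrow> 'a::zero) \<Rightarrow> nat" where
  "num_zeros n x = card {i \<in> {1..n}. x i = 0}"

definition orbit_partition :: "nat \<Rightarrow> nat \<Rightarrow> (nat \<Rightarrow> 'a::comm_semiring_1) \<Rightarrow> nat list" where
  "orbit_partition r n x =
     (let A = {i \<in> {1..n}. x i \<noteq> 0};
          multiplicity_of = (\<lambda>v. card {i \<in> A. x i ^ r = v})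
      in rev (sorted_list_of_multiset
           (image_mset multiplicity_of (mset_set ((\<lambda>i. x i ^ r) ` A)))))"

lemma is_partition_orbit_partition:
  "is_partition (n - num_zeros n x) (orbit_partition r n x)"
proof -
  define A where "A = {i \<in> {1..n}. x i \<noteq> 0}"
  define P where "P = image_mset (\<lambda>v. card {i \<in> A. x i ^ r = v}) (mset_set ((\<lambda>i. x i ^ r) ` A))"
  have fin: "finite A" by (simp add: A_def)
  have eq: "orbit_partition r n x = rev (sorted_list_of_multiset P)"
    by (simp add: orbit_partition_def A_def P_def Let_def)
  have "num_zeros n x + card A = card ({i \<in> {1..n}. x i = 0} \<union> A)"
    unfolding num_zeros_def by (subst card_Un_disjoint) (auto simp: A_def)
  also have "{i \<in> {1..n}. x i = 0} \<union> A = {1..n}" by (auto simp: A_def)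
  finally have cA: "card A = n - num_zeros n x" by simp
  have "sum_list (orbit_partition r n x) = sum_mset (mset (sorted_list_of_multiset P))"
    unfolding eq by (simp only: sum_mset_sum_list sum_list_rev)
  also have "\<dots> = (\<Sum>v\<in>(\<lambda>i. x i ^ r) ` A. card {i \<in> A. x i ^ r = v})"
    by (simp add: P_def sum_unfold_sum_mset)
  also have "\<dots> = card A"
    using sum.image_gen[OF fin, of "\<lambda>_. 1::nat" "\<lambda>i. x i ^ r"] by simp
  finally have "sum_list (orbit_partition r n x) = n - num_zeros n x" using cA by simp
  moreover have "sorted_wrt (\<ge>) (orbit_partition r n x)"
    unfolding eq by (simp add: sorted_wrt_rev)
  moreover have "0 \<notin> set (orbit_partition r n x)"
    unfolding eq using fin by (auto simp: P_def card_eq_0_iff)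
  ultimately show ?thesis by (simp add: is_partition_def)
qed


section \<open>Specht ideals\<close>

text \<open>Boxes are pairs (row, column), both counted from zero.\<close>

definition young_diagram :: "nat list \<Rightarrow> (nat \<times> nat) set" where
  "young_diagram \<mu> = {(i, j). i < length \<mu> \<and> j < \<mu> ! i}"

definition is_tableau :: "nat \<Rightarrow> nat list \<Rightarrow> (nat \<times> nat \<Rightarrow> nat) \<Rightarrow> bool" where
  "is_tableau N \<mu> T \<longleftrightarrow> bij_betw T (young_diagram \<mu>) {1..N}"

definition specht_poly :: "nat list \<Rightarrow> (nat \<times> nat \<Rightarrow> nat) \<Rightarrow> 'a::comm_ring_1 mpoly" where
  "specht_poly \<mu> T =
     (\<Prod>j\<in>snd ` young_diagram \<mu>.
        \<Prod>(i, i')\<in>{(i, i'). (i, j) \<in> young_diagram \<mu> \<and> (i', j) \<in> young_diagram \<mu> \<and> i < i'}.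
          Var (T (i, j)) - Var (T (i', j)))"

definition specht_ideal :: "nat \<Rightarrow> nat list \<Rightarrow> 'a::comm_ring_1 mpoly set" where
  "specht_ideal N \<mu> = genideal (mpoly_ring {1..N}) {specht_poly \<mu> T | T. is_tableau N \<mu> T}"

text \<open>
  \<open>\<phi>\<^sub>S\<close> sends \<open>y\<^sub>j\<close> to \<open>x\<^sub>i\<^sup>r\<close>, where \<open>i\<close> is the \<open>j\<close>-th smallest element of \<open>S\<close>;
  list positions are counted from zero. Only its values on
  \<open>mpoly_ring {1..card S}\<close> are meaningful.
\<close>

definition phi :: "nat \<Rightarrow> nat set \<Rightarrow> 'a::comm_ring_1 mpoly \<Rightarrow> 'a mpoly" where
  "phi r S = insertion Const (\<lambda>j. Var (sorted_list_of_set S ! (j - 1)) ^ r)"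

lemma phi_algebra_hom:
  fixes p q :: "'a::comm_ring_1 mpoly" and c :: 'a
  shows "phi r S (p + q) = phi r S p + phi r S q"
    and "phi r S (p * q) = phi r S p * phi r S q"
    and "phi r S (Const c) = Const c"
    and "phi r S (Var j) = (Var (sorted_list_of_set S ! (j - 1)) ^ r :: 'a mpoly)"
proof -
  have Const: "Const 0 = (0 :: 'a mpoly)" "Const 1 = (1 :: 'a mpoly)"
    "\<And>a b :: 'a. Const (a + b) = Const a + Const b" "\<And>a b :: 'a. Const (a * b) = Const a * Const b"
    by (simp_all add: Const_def single_add mult_single)
  show "phi r S (p + q) = phi r S p + phi r S q" "phi r S (p * q) = phi r S p * phi r S q"
    "phi r S (Const c) = Const c" "phi r S (Var j) = (Var (sorted_list_of_set S ! (j - 1)) ^ r :: 'a mpoly)"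
    unfolding phi_def by (simp_all add: insertion_add insertion_mult Const)
qed

definition ideal_more_zeros :: "nat \<Rightarrow> nat \<Rightarrow> 'a::comm_ring_1 mpoly set" where
  "ideal_more_zeros n z =
     genideal (mpoly_ring {1..n}) {\<Prod>i\<in>A. Var i | A. A \<subseteq> {1..n} \<and> card A = n - z}"

definition orbit_specht_ideal :: "nat \<Rightarrow> nat \<Rightarrow> nat list \<Rightarrow> nat \<Rightarrow> 'a::comm_ring_1 mpoly set" where
  "orbit_specht_ideal r n \<mu> z =
     (\<Inter>S\<in>{S. S \<subseteq> {1..n} \<and> card S = n - z}.
        genideal (mpoly_ring {1..n}) (Var ` ({1..n} - S) \<union> phi r S ` specht_ideal (n - z) \<mu>))
     \<inter> ideal_more_zeros n z"

end

(*
Over a field the zero set of a finite intersection of ideals is the union of the zero sets. A point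
with more than z zeros is a zero of I_{>=z+1}. A point with at most z zeros can only be a zero of
X_S + phi_S(I_mu) if it has exactly z zeros and S is its support. It then remains to decide when
all Specht polynomials of shape mu vanish at a point y. Some Specht polynomial of shape mu does not
vanish at y exactly if the coordinates of y can be placed in the boxes of mu with distinct entries in
each column, and by a Gale-Ryser type argument this is possible exactly if the multiplicity
partition of y is dominated by mu.
*)

theory Submission
  imports Defs
begin

section \<open>Evaluation and vanishing\<close>

lemma insertion_id_add [simp]:
  fixes p q :: "'a::comm_ring_1 mpoly"
  shows "insertion id x (p + q) = insertion id x p + insertion id x q"
  by (rule insertion_add) simp_all

lemma insertion_id_mult [simp]:
  fixes p q :: "'a::comm_ring_1 mpoly"
  shows "insertion id x (p * q) = insertion id x p * insertion id x q"
  by (rule insertion_mult) simp_all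

lemma insertion_id_zero [simp]: "insertion id x (0 :: 'a::comm_ring_1 mpoly) = 0"
  by (simp add: insertion_def)

lemma insertion_id_one [simp]: "insertion id x (1 :: 'a::comm_ring_1 mpoly) = 1"
  by (simp add: insertion_def)

lemma insertion_id_diff [simp]:
  fixes p q :: "'a::comm_ring_1 mpoly"
  shows "insertion id x (p - q) = insertion id x p - insertion id x q"
  using insertion_id_add[of x "p - q" q] by (simp add: algebra_simps)

lemma insertion_id_uminus [simp]:
  fixes p :: "'a::comm_ring_1 mpoly"
  shows "insertion id x (- p) = - insertion id x p"
  using insertion_id_diff[of x 0 p] by simp

(* Unification in the induction rule leaves the eta-expanded form of id, which id_apply would
   rewrite to the identity abstraction, out of reach of the rules above. *)
lemma insertion_id_power [simp]:
  fixes p :: "'a::comm_ring_1 mpoly"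
  shows "insertion id x (p ^ k) = insertion id x p ^ k"
  by (induction k) (simp_all del: id_apply)

lemma insertion_id_sum [simp]:
  fixes p :: "'b \<Rightarrow> 'a::comm_ring_1 mpoly"
  shows "insertion id x (sum p A) = (\<Sum>a\<in>A. insertion id x (p a))"
  by (induction A rule: infinite_finite_induct) (simp_all del: id_apply)

lemma insertion_id_prod [simp]:
  fixes p :: "'b \<Rightarrow> 'a::comm_ring_1 mpoly"
  shows "insertion id x (prod p A) = (\<Prod>a\<in>A. insertion id x (p a))"
  by (induction A rule: infinite_finite_induct) (simp_all del: id_apply)

text \<open>Turns vanishing on the image of \<open>phi\<close> at \<open>x\<close> into vanishing on
  the Specht ideal itself at a point of r-th powers.\<close>

lemma insertion_id_phi:
  fixes p :: "'a::comm_ring_1 mpoly"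
  shows "insertion id x (phi r S p) = insertion id (\<lambda>j. x (sorted_list_of_set S ! (j - 1)) ^ r) p"
  \<comment> \<open>The instances leave the outer \<open>insertion id x\<close> folded, so that its
    homomorphism rules apply.\<close>
  by (simp add: phi_def insertion_def[of Const] insertion_def[of id "\<lambda>j. x (_ j) ^ r"])

section \<open>Membership in the polynomial rings\<close>

lemma carrier_mpoly_ring:
  "carrier (mpoly_ring V) = {p. \<forall>m\<in>Poly_Mapping.keys p. Poly_Mapping.keys m \<subseteq> V}"
  by (simp add: mpoly_ring_def)

lemma mpoly_ring_simps [simp]:
  "monoid.mult (mpoly_ring V) = (*)" "one (mpoly_ring V) = 1"
  "zero (mpoly_ring V) = 0" "add (mpoly_ring V) = (+)"
  by (simp_all add: mpoly_ring_def)

lemma ring_mpoly_ring: "ring (mpoly_ring V :: 'a::comm_ring_1 mpoly ring)"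
  by (rule cring.axioms(1)[OF cring_mpoly_ring])

lemma mpoly_ring_closed:
  fixes p q :: "'a::comm_ring_1 mpoly"
  assumes "p \<in> carrier (mpoly_ring V)" "q \<in> carrier (mpoly_ring V)"
  shows "p + q \<in> carrier (mpoly_ring V)" "p * q \<in> carrier (mpoly_ring V)"
    "p - q \<in> carrier (mpoly_ring V)"
proof -
  interpret cring "mpoly_ring V :: 'a mpoly ring" by (rule cring_mpoly_ring)
  show "p + q \<in> carrier (mpoly_ring V)" "p * q \<in> carrier (mpoly_ring V)"
    using a_closed[OF assms] m_closed[OF assms] by simp_all
  have "- q \<in> carrier (mpoly_ring V)"
    using assms(2) by (simp add: carrier_mpoly_ring)
  thus "p - q \<in> carrier (mpoly_ring V)"
    using a_closed[OF assms(1), of "- q"] by simp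
qed

lemma mpoly_ring_0_1_closed [simp]:
  "(0 :: 'a::comm_ring_1 mpoly) \<in> carrier (mpoly_ring V)"
  "(1 :: 'a mpoly) \<in> carrier (mpoly_ring V)"
  by (simp_all add: carrier_mpoly_ring)

lemma mpoly_ring_Var [simp]: "i \<in> V \<Longrightarrow> (Var i :: 'a::comm_ring_1 mpoly) \<in> carrier (mpoly_ring V)"
  by (simp add: carrier_mpoly_ring Var_def)

lemma mpoly_ring_Const [simp]: "(Const c :: 'a::comm_ring_1 mpoly) \<in> carrier (mpoly_ring V)"
  by (simp add: carrier_mpoly_ring Const_def)

lemma mpoly_ring_power:
  "(p :: 'a::comm_ring_1 mpoly) \<in> carrier (mpoly_ring V) \<Longrightarrow> p ^ k \<in> carrier (mpoly_ring V)"
  by (induction k) (auto intro: mpoly_ring_closed)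

lemma mpoly_ring_sum:
  fixes p :: "'b \<Rightarrow> 'a::comm_ring_1 mpoly"
  shows "(\<And>a. a \<in> A \<Longrightarrow> p a \<in> carrier (mpoly_ring V)) \<Longrightarrow> sum p A \<in> carrier (mpoly_ring V)"
  by (induction A rule: infinite_finite_induct) (auto intro: mpoly_ring_closed)

lemma mpoly_ring_prod:
  fixes p :: "'b \<Rightarrow> 'a::comm_ring_1 mpoly"
  shows "(\<And>a. a \<in> A \<Longrightarrow> p a \<in> carrier (mpoly_ring V)) \<Longrightarrow> prod p A \<in> carrier (mpoly_ring V)"
  by (induction A rule: infinite_finite_induct) (auto intro: mpoly_ring_closed)

lemma phi_closed:
  fixes p :: "'a::comm_ring_1 mpoly"
  assumes "finite S" "S \<subseteq> V" "p \<in> carrier (mpoly_ring {1..card S})"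
  shows "phi r S p \<in> carrier (mpoly_ring V)"
proof -
  have "sorted_list_of_set S ! (j - 1) \<in> V" if "j \<in> {1..card S}" for j
    using that assms(1,2) nth_mem[of "j - 1" "sorted_list_of_set S"] by auto
  thus ?thesis
    using assms(3) unfolding phi_def insertion_def
    by (intro mpoly_ring_sum mpoly_ring_closed mpoly_ring_prod mpoly_ring_power)
      (auto simp: carrier_mpoly_ring[of "{1..card S}"] subset_iff simp del: One_nat_def intro!: mpoly_ring_Var)
qed

section \<open>Vanishing of ideals at a point\<close>

lemma ideal_vanishing:
  "ideal {p \<in> carrier (mpoly_ring V). insertion id x p = 0} (mpoly_ring V :: 'a::comm_ring_1 mpoly ring)"
proof -
  interpret cring "mpoly_ring V :: 'a mpoly ring" by (rule cring_mpoly_ring)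
  \<comment> \<open>The group inverse is a definite description; uniqueness of inverses identifies
    it with \<open>- p\<close>.\<close>
  have neg: "inv\<^bsub>add_monoid (mpoly_ring V)\<^esub> p = - p" if "p \<in> carrier (mpoly_ring V)" for p :: "'a mpoly"
    using minus_equality[of "- p" p] that mpoly_ring_closed(3)[of 0 V p] by (simp add: a_inv_def)
  have "subgroup {p \<in> carrier (mpoly_ring V). insertion id x p = 0} (add_monoid (mpoly_ring V :: 'a mpoly ring))"
  proof
    fix p :: "'a mpoly" assume p: "p \<in> {p \<in> carrier (mpoly_ring V). insertion id x p = 0}"
    hence "- p \<in> carrier (mpoly_ring V)" by (simp add: carrier_mpoly_ring)
    thus "inv\<^bsub>add_monoid (mpoly_ring V)\<^esub> p \<in> {p \<in> carrier (mpoly_ring V). insertion id x p = 0}"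
      using p by (subst neg) simp_all
  qed (auto intro: mpoly_ring_closed)
  thus ?thesis
    by (intro idealI ring_mpoly_ring) (auto intro: mpoly_ring_closed)
qed

text \<open>The polynomials of the ring that vanish at \<open>x\<close> form an ideal, which by
  minimality contains the generated ideal as soon as it contains \<open>G\<close>.\<close>

lemma vanishing_genideal_iff:
  fixes G :: "'a::comm_ring_1 mpoly set"
  assumes "G \<subseteq> carrier (mpoly_ring V)"
  shows "(\<forall>p\<in>genideal (mpoly_ring V) G. insertion id x p = 0) \<longleftrightarrow> (\<forall>p\<in>G. insertion id x p = 0)"
  using ring.genideal_self[OF ring_mpoly_ring assms] assms
    ring.genideal_minimal[OF ring_mpoly_ring ideal_vanishing, of G V x]
  by blast

text \<open>If \<open>p\<close> in \<open>I\<close> and \<open>q\<close> in \<open>J\<close> are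
  both nonzero at \<open>x\<close>, then \<open>p * q\<close> lies in \<open>I \<inter> J\<close>
  and is nonzero at \<open>x\<close>, as there are no zero divisors.\<close>

lemma vanishing_Int_iff:
  fixes I J :: "'a::idom mpoly set"
  assumes "ideal I (mpoly_ring V)" "ideal J (mpoly_ring V)"
  shows "(\<forall>p\<in>I \<inter> J. insertion id x p = 0) \<longleftrightarrow>
    (\<forall>p\<in>I. insertion id x p = 0) \<or> (\<forall>p\<in>J. insertion id x p = 0)"
proof -
  have "p * q \<in> I \<inter> J" if "p \<in> I" "q \<in> J" for p q
    using ideal.I_r_closed[OF assms(1) that(1), of q] ideal.I_l_closed[OF assms(2) that(2), of p]
      ideal.Icarr[OF assms(1) that(1)] ideal.Icarr[OF assms(2) that(2)] by simp
  thus ?thesis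
    by (metis IntE insertion_id_mult no_zero_divisors)
qed

text \<open>The induction absorbs one \<open>J a\<close> after another into \<open>I\<close>.
  Keeping \<open>I\<close> also covers empty \<open>A\<close>, where the bare intersection is
  \<open>UNIV\<close> and not the carrier.\<close>

lemma vanishing_INT_iff:
  fixes I :: "'a::idom mpoly set"
  assumes "finite A" "\<And>a. a \<in> A \<Longrightarrow> ideal (J a) (mpoly_ring V)" "ideal I (mpoly_ring V)"
  shows "(\<forall>p\<in>(\<Inter>a\<in>A. J a) \<inter> I. insertion id x p = 0) \<longleftrightarrow>
    (\<exists>a\<in>A. \<forall>p\<in>J a. insertion id x p = 0) \<or> (\<forall>p\<in>I. insertion id x p = 0)"
  using assms
proof (induction A arbitrary: I)
  case empty
  thus ?case by simp
next
  case (insert a A)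
  have Ja: "ideal (J a) (mpoly_ring V)" using insert.prems(1) by simp
  have split: "(\<Inter>b\<in>insert a A. J b) \<inter> I = (\<Inter>b\<in>A. J b) \<inter> (J a \<inter> I)" by auto
  have IH: "(\<forall>p\<in>(\<Inter>b\<in>A. J b) \<inter> (J a \<inter> I). insertion id x p = 0) \<longleftrightarrow>
      (\<exists>b\<in>A. \<forall>p\<in>J b. insertion id x p = 0) \<or> (\<forall>p\<in>J a \<inter> I. insertion id x p = 0)"
    by (rule insert.IH) (simp_all add: insert.prems ring.i_intersect[OF ring_mpoly_ring])
  show ?case
    unfolding split IH vanishing_Int_iff[OF Ja insert.prems(2)] by (simp only: bex_simps disj_ac)
qed


section \<open>Column-injective fillings and dominance\<close>

lemma finite_young_diagram: "finite (young_diagram \<mu>)"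
proof -
  have "young_diagram \<mu> = (SIGMA i:{..<length \<mu>}. {..<\<mu> ! i})"
    by (auto simp: young_diagram_def)
  thus ?thesis by simp
qed

lemma card_young_diagram_row:
  "card {b \<in> young_diagram \<mu>. fst b = i} = (if i < length \<mu> then \<mu> ! i else 0)"
proof -
  have "{b \<in> young_diagram \<mu>. fst b = i} = Pair i ` {..<(if i < length \<mu> then \<mu> ! i else 0)}"
    by (auto simp: young_diagram_def)
  thus ?thesis by (simp add: card_image inj_on_def)
qed

text \<open>The default 0 past the end of \<open>xs\<close> matches \<open>take\<close>, so lists of
  different lengths can be compared as functions on \<open>nat\<close>.\<close>

lemma sum_nth_eq_sum_list_take:
  "(\<Sum>i<k. if i < length xs then xs ! i else 0) = sum_list (take k xs :: nat list)"
proof (induction k)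
  case (Suc k)
  thus ?case by (simp add: take_Suc_conv_app_nth)
qed simp

lemma card_eq_sum_fibres:
  assumes "finite D" "finite A"
  shows "card {b \<in> D. g b \<in> A} = (\<Sum>a\<in>A. card {b \<in> D. g b = a})"
proof -
  have "{b \<in> D. g b \<in> A} = (\<Union>a\<in>A. {b \<in> D. g b = a})" by auto
  also have "card \<dots> = (\<Sum>a\<in>A. card {b \<in> D. g b = a})"
    using assms by (intro card_UN_disjoint) auto
  finally show ?thesis .
qed

lemma card_young_diagram_rows:
  "card {b \<in> young_diagram \<mu>. fst b < k} = sum_list (take k \<mu>)"
  using card_eq_sum_fibres[OF finite_young_diagram, of "{..<k}" \<mu> fst]
  by (simp add: card_young_diagram_row sum_nth_eq_sum_list_take)

text \<open>Each column contains at most \<open>k\<close> boxes with value in \<open>W\<close>, hence at most as many as it has in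
  the first \<open>k\<close> rows.\<close>

lemma card_filling_le:
  assumes \<mu>: "sorted_wrt (\<ge>) \<mu>"
    and inj: "inj_on (\<lambda>b. (snd b, g b)) (young_diagram \<mu>)"
    and W: "finite W" "card W \<le> k"
  shows "card {b \<in> young_diagram \<mu>. g b \<in> W} \<le> sum_list (take k \<mu>)"
proof -
  let ?D = "young_diagram \<mu>"
  have column: "card {b \<in> ?D. g b \<in> W \<and> snd b = j} \<le> card {b \<in> ?D. fst b < k \<and> snd b = j}" for j
  proof -
    let ?C = "{b \<in> ?D. g b \<in> W \<and> snd b = j}"
    have "inj_on g ?C" using inj by (auto simp: inj_on_def)
    hence "card ?C \<le> card W"
      by (rule card_inj_on_le) (auto simp: W)
    hence k: "card ?C \<le> k" using W by simp
    \<comment> \<open>Either the whole column lies in the first \<open>k\<close> rows, or it has a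
      box further down; then, as \<open>\<mu>\<close> is weakly decreasing, it meets each of the
      first \<open>k\<close> rows.\<close>
    show ?thesis
    proof (cases "\<forall>b\<in>?D. snd b = j \<longrightarrow> fst b < k")
      case True
      thus ?thesis by (intro card_mono) (auto simp: finite_young_diagram)
    next
      case False
      then obtain a where a: "(a, j) \<in> ?D" "a \<ge> k" by force
      have "(\<lambda>i. (i, j)) ` {..<k} \<subseteq> {b \<in> ?D. fst b < k \<and> snd b = j}"
      proof (clarsimp)
        fix i assume "i < k"
        thus "(i, j) \<in> ?D"
          using a sorted_wrt_nth_less[OF \<mu>, of i a] by (simp add: young_diagram_def)
      qed
      hence "card ((\<lambda>i. (i, j)) ` {..<k}) \<le> card {b \<in> ?D. fst b < k \<and> snd b = j}"
        by (intro card_mono) (auto simp: finite_young_diagram)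
      thus ?thesis using k by (simp add: card_image inj_on_def)
    qed
  qed
  have columns: "card {b \<in> ?D. P b} = (\<Sum>j\<in>snd ` ?D. card {b \<in> ?D. P b \<and> snd b = j})" for P
  proof -
    have "{b \<in> {b \<in> ?D. P b}. snd b \<in> snd ` ?D} = {b \<in> ?D. P b}" by auto
    thus ?thesis
      using card_eq_sum_fibres[of "{b \<in> ?D. P b}" "snd ` ?D" snd]
      by (simp add: finite_young_diagram conj_ac)
  qed
  have "card {b \<in> ?D. g b \<in> W} \<le> card {b \<in> ?D. fst b < k}"
    by (subst (1 2) columns) (intro sum_mono column)
  thus ?thesis by (simp add: card_young_diagram_rows)
qed

section \<open>Moving single units of content\<close>

lemma sum_fun_upd_transfer:
  fixes a a' :: "nat \<Rightarrow> nat"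
  assumes "finite A" "i \<noteq> j" "a i \<ge> 1"
    and "\<And>v. a' v = (if v = i then a i - 1 else if v = j then a j + 1 else a v)"
  shows "sum a' A + (if i \<in> A then 1 else 0) = sum a A + (if j \<in> A then 1 else 0)"
proof -
  \<comment> \<open>Indicator sums keep the identity additive, since subtraction on
    \<open>nat\<close> truncates. With \<open>A = {..<k}\<close> it gives the change of a partial
    sum.\<close>
  have "sum a' A + (\<Sum>v\<in>A. if v = i then 1 else 0) = sum a A + (\<Sum>v\<in>A. if v = j then 1 else 0)"
    unfolding sum.distrib[symmetric] using assms by (intro sum.cong) auto
  thus ?thesis using assms(1) by (simp add: sum.delta)
qed

text \<open>If the value \<open>i\<close> is more frequent than \<open>j\<close>, some column contains \<open>i\<close> but not \<open>j\<close>, and there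
  \<open>i\<close> can be replaced by \<open>j\<close>. Such steps lower the content of the filling in dominance order; taking
  \<open>i\<close> to be the first value with a surplus and \<open>j\<close> the first value after it with a deficit keeps the
  content above \<open>\<kappa>\<close>.\<close>

lemma exists_filling_with_content:
  fixes g :: "'b \<Rightarrow> nat" and \<kappa> :: "nat \<Rightarrow> nat" and col :: "'b \<Rightarrow> 'c"
  assumes D: "finite D" and \<kappa>: "antimono \<kappa>"
    and inj: "inj_on (\<lambda>b. (col b, g b)) D"
    and dom: "\<And>k. (\<Sum>i<k. \<kappa> i) \<le> (\<Sum>i<k. card {b \<in> D. g b = i})"
    and total: "(\<Sum>i<M. \<kappa> i) = (\<Sum>i<M. card {b \<in> D. g b = i})"
  shows "\<exists>g'. inj_on (\<lambda>b. (col b, g' b)) D \<and> (\<forall>i<M. card {b \<in> D. g' b = i} = \<kappa> i)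
    \<and> (\<forall>b\<in>D. g b < M \<longrightarrow> g' b < M)"
  using inj dom total
\<comment> \<open>The measure is the total surplus over \<open>\<kappa>\<close>: truncated
  subtraction counts deficits as 0.\<close>
proof (induction "\<Sum>i<M. card {b \<in> D. g b = i} - \<kappa> i" arbitrary: g rule: less_induct)
  case less
  define a where "a v = card {b \<in> D. g b = v}" for v
  have dom: "(\<Sum>i<k. \<kappa> i) \<le> (\<Sum>i<k. a i)" for k using less.prems(2) by (simp add: a_def)
  have total: "(\<Sum>i<M. \<kappa> i) = (\<Sum>i<M. a i)" using less.prems(3) by (simp add: a_def)
  show ?case
  proof (cases "\<forall>i<M. a i = \<kappa> i")
    case True
    thus ?thesis using less.prems(1) by (intro exI[of _ g]) (simp add: a_def)
  next
    case False
    define i where "i = (LEAST i. a i \<noteq> \<kappa> i)"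
    have i: "a i \<noteq> \<kappa> i" "\<And>v. v < i \<Longrightarrow> a v = \<kappa> v"
      using False LeastI_ex[of "\<lambda>i. a i \<noteq> \<kappa> i"] not_less_Least[of _ "\<lambda>i. a i \<noteq> \<kappa> i"]
      unfolding i_def by blast+
    have iM: "i < M" using False i(2) by (meson linorder_not_less less_le_trans)
    \<comment> \<open>The partial sums below \<open>i\<close> agree, so dominance at
      \<open>Suc i\<close> makes the first difference a surplus.\<close>
    have "(\<Sum>v<i. \<kappa> v) = (\<Sum>v<i. a v)" using i(2) by (intro sum.cong) auto
    hence surplus: "\<kappa> i < a i" using dom[of "Suc i"] i(1) by simp
    \<comment> \<open>Equal totals up to \<open>M\<close> require a deficit to balance this
      surplus.\<close>
    have "\<exists>j<M. a j < \<kappa> j"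
    proof (rule ccontr)
      assume "\<not> ?thesis"
      hence "(\<Sum>v<M. \<kappa> v) < (\<Sum>v<M. a v)"
        using surplus iM by (intro sum_strict_mono_ex1) force+
      thus False using total by simp
    qed
    then obtain j0 where j0: "j0 < M" "a j0 < \<kappa> j0" by blast
    define j where "j = (LEAST j. a j < \<kappa> j)"
    have j: "a j < \<kappa> j" "\<And>v. v < j \<Longrightarrow> \<kappa> v \<le> a v"
      using j0 not_less_Least unfolding j_def by (auto intro: LeastI simp: not_less[symmetric])
    have jM: "j < M" using j0 j(2) by (meson linorder_not_less less_le_trans)
    have ij: "i < j" using j(1) i surplus by (metis less_irrefl less_asym linorder_neqE_nat)
    have "a j < a i" using j(1) surplus antimonoD[OF \<kappa>, of i j] ij by simp
    \<comment> \<open>Boxes with equal value lie in distinct columns, so \<open>a v\<close> counts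
      the columns containing \<open>v\<close>; by \<open>a j < a i\<close> some column contains
      \<open>i\<close> but not \<open>j\<close>.\<close>
    have "\<exists>b\<in>D. g b = i \<and> (\<forall>b'\<in>D. g b' = j \<longrightarrow> col b' \<noteq> col b)"
    proof (rule ccontr)
      assume "\<not> ?thesis"
      hence sub: "col ` {b \<in> D. g b = i} \<subseteq> col ` {b \<in> D. g b = j}"
        by (smt (verit) image_subset_iff imageI mem_Collect_eq)
      have "inj_on col {b \<in> D. g b = v}" for v
        using less.prems(1) by (auto simp: inj_on_def)
      hence "a v = card (col ` {b \<in> D. g b = v})" for v
        by (simp add: a_def card_image)
      hence "a i \<le> a j" using card_mono[OF _ sub] D by simp
      thus False using \<open>a j < a i\<close> by simp
    qed
    then obtain b0 where b0: "b0 \<in> D" "g b0 = i" "\<And>b. b \<in> D \<Longrightarrow> g b = j \<Longrightarrow> col b \<noteq> col b0"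
      by blast
    define h where "h = g(b0 := j)"
    define a' where "a' v = card {b \<in> D. h b = v}" for v
    have a': "a' v = (if v = i then a i - 1 else if v = j then a j + 1 else a v)" for v
    proof -
      have "{b \<in> D. h b = i} = {b \<in> D. g b = i} - {b0}"
        "{b \<in> D. h b = j} = insert b0 {b \<in> D. g b = j}"
        "v \<noteq> i \<Longrightarrow> v \<noteq> j \<Longrightarrow> {b \<in> D. h b = v} = {b \<in> D. g b = v}"
        using b0 ij by (auto simp: h_def)
      thus ?thesis using b0(1,2) D ij by (auto simp: a'_def a_def)
    qed
    have transfer: "sum a' A + (if i \<in> A then 1 else 0) = sum a A + (if j \<in> A then 1 else 0)"
      if "finite A" for A
      by (rule sum_fun_upd_transfer[OF that _ _ a']) (use ij surplus in auto)
    have "inj_on (\<lambda>b. (col b, h b)) D"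
      using less.prems(1) b0 by (fastforce simp: inj_on_def h_def)
    \<comment> \<open>A partial sum loses a unit only for \<open>i < k \<le> j\<close>. There
      \<open>i\<close> has a surplus and no value below \<open>k\<close> has a deficit, so the
      inequality was strict.\<close>
    moreover have "(\<Sum>v<k. \<kappa> v) \<le> (\<Sum>v<k. a' v)" for k
    proof (cases "i < k \<and> k \<le> j")
      case True
      have "(\<Sum>v<k. \<kappa> v) < (\<Sum>v<k. a v)"
        using True surplus j(2) by (intro sum_strict_mono_ex1) auto
      thus ?thesis using transfer[of "{..<k}"] True by simp
    next
      case False
      thus ?thesis using transfer[of "{..<k}"] dom[of k] ij by (auto split: if_splits)
    qed
    moreover have "(\<Sum>v<M. \<kappa> v) = (\<Sum>v<M. a' v)"
      using transfer[of "{..<M}"] total iM jM by simp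
    \<comment> \<open>The surplus at \<open>i\<close> drops by one, and by
      \<open>a j < \<kappa> j\<close> the extra unit at \<open>j\<close> creates none.\<close>
    moreover have "(\<Sum>v<M. a' v - \<kappa> v) < (\<Sum>v<M. a v - \<kappa> v)"
      using iM surplus j(1) ij by (intro sum_strict_mono_ex1) (auto simp: a')
    ultimately obtain g' where "inj_on (\<lambda>b. (col b, g' b)) D" "\<forall>v<M. card {b \<in> D. g' b = v} = \<kappa> v"
      "\<forall>b\<in>D. h b < M \<longrightarrow> g' b < M"
      using less.hyps[of h] unfolding a_def a'_def by blast
    thus ?thesis using jM by (intro exI[of _ g']) (auto simp: h_def)
  qed
qed

section \<open>Bijective fillings and multiplicity partitions\<close>

lemma exists_bij_betw_fibres:
  assumes "finite D" "finite A"
    and "\<And>v. card {b \<in> D. g b = v} = card {a \<in> A. f a = v}"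
  shows "\<exists>T. bij_betw T D A \<and> (\<forall>b\<in>D. f (T b) = g b)"
proof -
  have "\<exists>h. bij_betw h {b \<in> D. g b = v} {a \<in> A. f a = v}" for v
    using assms by (intro finite_same_card_bij) auto
  then obtain h where h: "\<And>v. bij_betw (h v) {b \<in> D. g b = v} {a \<in> A. f a = v}" by metis
  \<comment> \<open>The bijections between corresponding fibres are glued along the value
    \<open>g b\<close>.\<close>
  define T where "T b = h (g b) b" for b
  have "bij_betw T D A"
    unfolding bij_betw_def
  proof (intro conjI inj_onI equalityI subsetI)
    fix b c assume *: "b \<in> D" "c \<in> D" "T b = T c"
    have "f (T b) = g b" "f (T c) = g c"
      using *(1,2) bij_betwE[OF h] by (auto simp: T_def)
    hence "g b = g c" using *(3) by simp
    thus "b = c" using * bij_betw_imp_inj_on[OF h, of "g b"] by (auto simp: T_def inj_on_def)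
  next
    fix a assume "a \<in> T ` D" thus "a \<in> A" using bij_betwE[OF h] by (auto simp: T_def)
  next
    fix a assume "a \<in> A"
    hence "a \<in> h (f a) ` {b \<in> D. g b = f a}" using bij_betw_imp_surj_on[OF h, of "f a"] by auto
    then obtain b where "b \<in> D" "T b = a" by (auto simp: T_def)
    thus "a \<in> T ` D" by blast
  qed
  moreover have "\<forall>b\<in>D. f (T b) = g b" using bij_betwE[OF h] by (auto simp: T_def)
  ultimately show ?thesis by blast
qed

text \<open>Generalizes \<open>orbit_partition\<close> from the support to any set \<open>A\<close>,
  so that it applies to a set \<open>S\<close> not yet known to be the support.\<close>

definition multiplicity_partition :: "('b \<Rightarrow> 'v) \<Rightarrow> 'b set \<Rightarrow> nat list" where
  "multiplicity_partition f A =
     rev (sorted_list_of_multiset (image_mset (\<lambda>v. card {a \<in> A. f a = v}) (mset_set (f ` A))))"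

text \<open>Sorting the values by multiplicity names the value behind each part, so that partial
  sums of parts become counts of elements of \<open>A\<close>.\<close>

lemma multiplicity_partition_eq_map:
  assumes "finite A"
  obtains vs where "distinct vs" "set vs = f ` A"
    "multiplicity_partition f A = map (\<lambda>v. card {a \<in> A. f a = v}) vs"
proof -
  define c where "c v = card {a \<in> A. f a = v}" for v
  obtain us where us: "set us = f ` A" "distinct us"
    using finite_distinct_list[of "f ` A"] assms by auto
  define ws where "ws = sort_key c us"
  have "sorted_list_of_multiset (image_mset c (mset_set (f ` A))) = map c ws"
  proof -
    have "mset_set (f ` A) = mset us" using us mset_set_set[of us] by simp
    hence "sorted_list_of_multiset (image_mset c (mset_set (f ` A))) = sort (map c us)"
      by (simp flip: mset_map)
    also have "\<dots> = map c ws"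
      by (rule properties_for_sort) (simp_all add: ws_def)
    finally show ?thesis .
  qed
  hence "multiplicity_partition f A = map c (rev ws)"
    by (simp add: multiplicity_partition_def c_def[abs_def] rev_map)
  thus ?thesis using us by (intro that[of "rev ws"]) (auto simp: ws_def c_def[abs_def])
qed

lemma sorted_multiplicity_partition: "sorted_wrt (\<ge>) (multiplicity_partition f A)"
  by (simp add: multiplicity_partition_def sorted_wrt_rev)

text \<open>This is the criterion \<open>K\<^sub>\<mu>\<^sub>\<kappa> \<noteq> 0 \<longleftrightarrow> \<kappa> \<unlhd> \<mu>\<close> for Kostka numbers.\<close>

lemma exists_column_injective_iff:
  assumes A: "finite A" and \<mu>: "is_partition (card A) \<mu>"
  shows "(\<exists>T. bij_betw T (young_diagram \<mu>) A \<and> inj_on (\<lambda>b. (snd b, f (T b))) (young_diagram \<mu>))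
    \<longleftrightarrow> multiplicity_partition f A \<unlhd>\<^sub>d \<mu>"
proof -
  let ?D = "young_diagram \<mu>"
  define c where "c v = card {a \<in> A. f a = v}" for v
  obtain vs where vs: "distinct vs" "set vs = f ` A" "multiplicity_partition f A = map c vs"
    using multiplicity_partition_eq_map[OF A, of f] unfolding c_def by blast
  have sorted: "sorted_wrt (\<ge>) \<mu>" and sum_\<mu>: "sum_list \<mu> = card A"
    using \<mu> by (auto simp: is_partition_def)
  have card_vs: "card {a \<in> A. f a \<in> set us} = sum_list (map c us)" if "distinct us" for us
    using card_eq_sum_fibres[OF A, of "set us" f] that by (simp add: c_def sum_list_distinct_conv_sum_set)
  show ?thesis
  proof
    assume "\<exists>T. bij_betw T ?D A \<and> inj_on (\<lambda>b. (snd b, f (T b))) ?D"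
    then obtain T where T: "bij_betw T ?D A" "inj_on (\<lambda>b. (snd b, f (T b))) ?D" by blast
    \<comment> \<open>The first \<open>k\<close> entries of \<open>vs\<close> serve as the set
      \<open>W\<close> of \<open>card_filling_le\<close>.\<close>
    have "sum_list (take k (map c vs)) \<le> sum_list (take k \<mu>)" for k
    proof -
      let ?W = "set (take k vs)"
      have "bij_betw T {b \<in> ?D. f (T b) \<in> ?W} {a \<in> A. f a \<in> ?W}"
        using T(1) by (auto simp: bij_betw_def inj_on_def)
      hence "card {a \<in> A. f a \<in> ?W} = card {b \<in> ?D. f (T b) \<in> ?W}"
        by (simp add: bij_betw_same_card)
      also have "\<dots> \<le> sum_list (take k \<mu>)"
        using card_length[of "take k vs"] by (intro card_filling_le[OF sorted T(2)]) auto
      finally show ?thesis using card_vs[of "take k vs"] vs(1) by (simp add: take_map)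
    qed
    thus "multiplicity_partition f A \<unlhd>\<^sub>d \<mu>" by (simp add: dominated_def vs(3))
  next
    assume dom: "multiplicity_partition f A \<unlhd>\<^sub>d \<mu>"
    \<comment> \<open>\<open>\<kappa>\<close> is the target content. The starting filling
      \<open>fst\<close> puts its row index into each box and has content \<open>\<mu>\<close>; the
      value \<open>i\<close> will stand for \<open>vs ! i\<close>.\<close>
    define \<kappa> where "\<kappa> i = (if i < length (map c vs) then map c vs ! i else 0)" for i
    \<comment> \<open>Long enough for both lists, so that sums up to \<open>M\<close> are full
      sums.\<close>
    define M where "M = max (length vs) (length \<mu>)"
    have sum_\<kappa>: "(\<Sum>i<k. \<kappa> i) = sum_list (take k (map c vs))" for k
      unfolding \<kappa>_def by (rule sum_nth_eq_sum_list_take)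
    have sum_rows: "(\<Sum>i<k. card {b \<in> ?D. fst b = i}) = sum_list (take k \<mu>)" for k
      by (simp add: card_young_diagram_row sum_nth_eq_sum_list_take)
    have "antimono \<kappa>"
    proof (rule antimonoI)
      fix i j :: nat assume "i \<le> j"
      thus "\<kappa> j \<le> \<kappa> i"
        using sorted_wrt_nth_less[OF sorted_multiplicity_partition[of f A], of i j]
        by (cases "i = j") (auto simp: \<kappa>_def vs(3))
    qed
    moreover have "inj_on (\<lambda>b. (snd b, fst b)) ?D" by (auto simp: inj_on_def)
    moreover have "(\<Sum>i<k. \<kappa> i) \<le> (\<Sum>i<k. card {b \<in> ?D. fst b = i})" for k
      using dom by (simp add: sum_\<kappa> sum_rows dominated_def vs(3))
    moreover have "(\<Sum>i<M. \<kappa> i) = (\<Sum>i<M. card {b \<in> ?D. fst b = i})"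
    proof -
      have "{a \<in> A. f a \<in> set vs} = A" using vs(2) by auto
      hence "sum_list (map c vs) = sum_list \<mu>" using card_vs[OF vs(1)] sum_\<mu> by simp
      thus ?thesis by (simp add: sum_\<kappa> sum_rows M_def)
    qed
    ultimately obtain g where g: "inj_on (\<lambda>b. (snd b, g b)) ?D"
      "\<forall>i<M. card {b \<in> ?D. g b = i} = \<kappa> i" "\<forall>b\<in>?D. fst b < M \<longrightarrow> g b < M"
      using exists_filling_with_content[OF finite_young_diagram, of \<kappa> snd fst \<mu> M] by blast
    \<comment> \<open>Row indices are below \<open>M\<close>, so all values of \<open>g\<close> are
      too, and those from \<open>length vs\<close> on have target content 0.\<close>
    have g_less: "g b < length vs" if "b \<in> ?D" for b
    proof (rule ccontr)
      assume "\<not> g b < length vs"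
      moreover have "g b < M" using g(3) that by (auto simp: young_diagram_def M_def)
      ultimately have "card {b' \<in> ?D. g b' = g b} = 0" using g(2) by (simp add: \<kappa>_def)
      moreover have "finite {b' \<in> ?D. g b' = g b}" by (simp add: finite_young_diagram)
      ultimately have "{b' \<in> ?D. g b' = g b} = {}" by (meson card_0_eq)
      thus False using that by blast
    qed
    have vs_inj: "i = j" if "vs ! i = vs ! j" "i < length vs" "j < length vs" for i j
      using that vs(1) by (simp add: nth_eq_iff_index_eq)
    have "card {b \<in> ?D. vs ! g b = v} = c v" for v
    proof (cases "v \<in> set vs")
      case True
      then obtain i where i: "i < length vs" "v = vs ! i" by (auto simp: in_set_conv_nth)
      have "{b \<in> ?D. vs ! g b = v} = {b \<in> ?D. g b = i}" using i g_less vs_inj by blast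
      thus ?thesis using g(2) i by (simp add: \<kappa>_def M_def)
    next
      case False
      hence "{b \<in> ?D. vs ! g b = v} = {}" "{a \<in> A. f a = v} = {}"
        using g_less vs(2) by auto
      thus ?thesis unfolding c_def by (simp only: card.empty)
    qed
    then obtain T where T: "bij_betw T ?D A" "\<forall>b\<in>?D. f (T b) = vs ! g b"
      using exists_bij_betw_fibres[OF finite_young_diagram A, of \<mu> "\<lambda>b. vs ! g b" f]
      unfolding c_def by blast
    have "inj_on (\<lambda>b. (snd b, f (T b))) ?D"
      using g(1) T(2) g_less vs_inj by (auto simp: inj_on_def)
    thus "\<exists>T. bij_betw T ?D A \<and> inj_on (\<lambda>b. (snd b, f (T b))) ?D" using T(1) by blast
  qed
qed


section \<open>Zeros of Specht ideals\<close>

text \<open>In a domain a finite product vanishes only if a factor does, and each factor compares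
  two boxes of one column. Pairing with \<open>snd b\<close> merges injectivity on the columns into
  one condition.\<close>

lemma insertion_specht_poly_nonzero_iff:
  fixes y :: "nat \<Rightarrow> 'a::idom"
  shows "insertion id y (specht_poly \<mu> T) \<noteq> 0 \<longleftrightarrow> inj_on (\<lambda>b. (snd b, y (T b))) (young_diagram \<mu>)"
proof -
  let ?D = "young_diagram \<mu>"
  let ?P = "\<lambda>j. {(i, i'). (i, j) \<in> ?D \<and> (i', j) \<in> ?D \<and> i < i'}"
  \<comment> \<open>A product over an infinite set defaults to 1, so the factors can be read off
    only after finiteness.\<close>
  have "finite (?P j)" for j
    by (rule finite_subset[of _ "fst ` ?D \<times> fst ` ?D"]) (force simp: finite_young_diagram)+
  hence "insertion id y (specht_poly \<mu> T) \<noteq> 0 \<longleftrightarrow>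
      (\<forall>j\<in>snd ` ?D. \<forall>(i, i')\<in>?P j. y (T (i, j)) \<noteq> y (T (i', j)))"
    by (auto simp: specht_poly_def finite_young_diagram case_prod_unfold)
  also have "\<dots> \<longleftrightarrow> inj_on (\<lambda>b. (snd b, y (T b))) ?D"
  proof
    assume L: "\<forall>j\<in>snd ` ?D. \<forall>(i, i')\<in>?P j. y (T (i, j)) \<noteq> y (T (i', j))"
    hence L: "y (T (i, j)) \<noteq> y (T (i', j))" if "(i, j) \<in> ?D" "(i', j) \<in> ?D" "i < i'" for i i' j
      using that by force
    show "inj_on (\<lambda>b. (snd b, y (T b))) ?D"
    proof (rule inj_onI, clarsimp)
      fix i i' j assume "(i, j) \<in> ?D" "(i', j) \<in> ?D" "y (T (i, j)) = y (T (i', j))"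
      thus "i = i'" using L[of i j i'] L[of i' j i] by (cases i i' rule: linorder_cases) auto
    qed
  next
    assume "inj_on (\<lambda>b. (snd b, y (T b))) ?D"
    thus "\<forall>j\<in>snd ` ?D. \<forall>(i, i')\<in>?P j. y (T (i, j)) \<noteq> y (T (i', j))"
      by (fastforce simp: inj_on_def)
  qed
  finally show ?thesis .
qed

lemma specht_poly_closed:
  "is_tableau N \<mu> T \<Longrightarrow> (specht_poly \<mu> T :: 'a::comm_ring_1 mpoly) \<in> carrier (mpoly_ring {1..N})"
  unfolding specht_poly_def is_tableau_def
  by (intro mpoly_ring_prod) (auto intro!: mpoly_ring_closed mpoly_ring_Var dest: bij_betwE)

lemma specht_ideal_subset: "(specht_ideal N \<mu> :: 'a::comm_ring_1 mpoly set) \<subseteq> carrier (mpoly_ring {1..N})"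
proof -
  have "ideal (specht_ideal N \<mu> :: 'a mpoly set) (mpoly_ring {1..N})"
    unfolding specht_ideal_def
    by (rule ring.genideal_ideal[OF ring_mpoly_ring]) (auto simp del: One_nat_def intro: specht_poly_closed)
  thus ?thesis by (auto dest: ideal.Icarr)
qed

text \<open>Relabelling along the increasing enumeration of \<open>S\<close> turns tableaux into
  bijections onto \<open>S\<close>, to which the column criterion applies.\<close>

lemma vanishing_phi_specht_ideal_iff:
  fixes x :: "nat \<Rightarrow> 'a::idom"
  assumes S: "finite S" and \<mu>: "is_partition (card S) \<mu>"
  shows "(\<forall>p\<in>phi r S ` specht_ideal (card S) \<mu>. insertion id x p = 0) \<longleftrightarrow>
    \<not> multiplicity_partition (\<lambda>i. x i ^ r) S \<unlhd>\<^sub>d \<mu>"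
proof -
  let ?D = "young_diagram \<mu>" and ?N = "card S"
  \<comment> \<open>Variables are counted from 1, list positions from 0.\<close>
  define e where "e j = sorted_list_of_set S ! (j - 1)" for j
  have e: "bij_betw e {1..?N} S"
  proof -
    have "bij_betw ((!) (sorted_list_of_set S)) {..<?N} S"
      using S by (intro bij_betw_nth) auto
    moreover have "bij_betw (\<lambda>j. j - 1) {1..?N} {..<?N}"
      by (rule bij_betw_byWitness[where f' = Suc]) auto
    ultimately have "bij_betw ((!) (sorted_list_of_set S) \<circ> (\<lambda>j. j - 1)) {1..?N} S"
      by (rule bij_betw_trans[rotated])
    thus ?thesis by (simp add: e_def[abs_def] comp_def)
  qed
  have "(\<forall>p\<in>phi r S ` specht_ideal ?N \<mu>. insertion id x p = 0) \<longleftrightarrow>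
      (\<forall>p\<in>specht_ideal ?N \<mu>. insertion id (\<lambda>j. x (e j) ^ r) p = 0)"
    by (simp add: insertion_id_phi e_def)
  also have "\<dots> \<longleftrightarrow> (\<forall>T. is_tableau ?N \<mu> T \<longrightarrow> insertion id (\<lambda>j. x (e j) ^ r) (specht_poly \<mu> T) = 0)"
    unfolding specht_ideal_def
    by (subst vanishing_genideal_iff) (auto simp del: One_nat_def intro: specht_poly_closed)
  also have "\<dots> \<longleftrightarrow> \<not> (\<exists>T. bij_betw T ?D {1..?N} \<and> inj_on (\<lambda>b. (snd b, x (e (T b)) ^ r)) ?D)"
    using insertion_specht_poly_nonzero_iff[of "\<lambda>j. x (e j) ^ r" \<mu>] by (auto simp: is_tableau_def)
  also have "(\<exists>T. bij_betw T ?D {1..?N} \<and> inj_on (\<lambda>b. (snd b, x (e (T b)) ^ r)) ?D) \<longleftrightarrow>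
      (\<exists>T. bij_betw T ?D S \<and> inj_on (\<lambda>b. (snd b, x (T b) ^ r)) ?D)"
  proof
    assume "\<exists>T. bij_betw T ?D {1..?N} \<and> inj_on (\<lambda>b. (snd b, x (e (T b)) ^ r)) ?D"
    thus "\<exists>T. bij_betw T ?D S \<and> inj_on (\<lambda>b. (snd b, x (T b) ^ r)) ?D"
      using bij_betw_trans[OF _ e] by fastforce
  next
    assume "\<exists>T. bij_betw T ?D S \<and> inj_on (\<lambda>b. (snd b, x (T b) ^ r)) ?D"
    then obtain T where T: "bij_betw T ?D S" "inj_on (\<lambda>b. (snd b, x (T b) ^ r)) ?D" by blast
    let ?T = "the_inv_into {1..?N} e \<circ> T"
    have "bij_betw ?T ?D {1..?N}"
      by (rule bij_betw_trans[OF T(1) bij_betw_the_inv_into[OF e]])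
    moreover have "e (?T b) = T b" if "b \<in> ?D" for b
      using that T(1) e by (auto intro!: f_the_inv_into_f_bij_betw dest: bij_betwE)
    hence "inj_on (\<lambda>b. (snd b, x (e (?T b)) ^ r)) ?D"
      using T(2) by (auto simp: inj_on_def)
    ultimately show "\<exists>T. bij_betw T ?D {1..?N} \<and> inj_on (\<lambda>b. (snd b, x (e (T b)) ^ r)) ?D" by blast
  qed
  also have "\<dots> \<longleftrightarrow> multiplicity_partition (\<lambda>i. x i ^ r) S \<unlhd>\<^sub>d \<mu>"
    by (rule exists_column_injective_iff[OF S \<mu>])
  finally show ?thesis .
qed

section \<open>Supports and the zeros of the orbit Specht ideal\<close>

lemma orbit_partition_eq_multiplicity_partition:
  "orbit_partition r n x = multiplicity_partition (\<lambda>i. x i ^ r) {i \<in> {1..n}. x i \<noteq> 0}"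
  by (simp add: orbit_partition_def multiplicity_partition_def Let_def)

lemma card_support: "card {i \<in> {1..n}. x i \<noteq> 0} = n - num_zeros n x"
proof -
  have "{i \<in> {1..n}. x i \<noteq> 0} = {1..n} - {i \<in> {1..n}. x i = 0}" by auto
  also have "card \<dots> = n - num_zeros n x"
    unfolding num_zeros_def by (subst card_Diff_subset) auto
  finally show ?thesis .
qed

lemma num_zeros_le: "num_zeros n x \<le> n"
proof -
  have "num_zeros n x \<le> card {1..n}"
    unfolding num_zeros_def by (intro card_mono) auto
  thus ?thesis by simp
qed

text \<open>A squarefree monomial is nonzero at \<open>x\<close> exactly when its variables lie in
  the support, so those of degree \<open>n - z\<close> all vanish exactly when the support is
  smaller than \<open>n - z\<close>.\<close>

lemma vanishing_ideal_more_zeros_iff: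
  fixes x :: "nat \<Rightarrow> 'a::idom"
  assumes "z \<le> n"
  shows "(\<forall>p\<in>ideal_more_zeros n z. insertion id x p = 0) \<longleftrightarrow> num_zeros n x > z"
proof -
  let ?S = "{i \<in> {1..n}. x i \<noteq> 0}"
  have "(\<forall>p\<in>ideal_more_zeros n z. insertion id x p = 0) \<longleftrightarrow>
      (\<forall>A. A \<subseteq> {1..n} \<and> card A = n - z \<longrightarrow> insertion id x (\<Prod>i\<in>A. Var i) = 0)"
    unfolding ideal_more_zeros_def
    by (subst vanishing_genideal_iff) (blast intro: mpoly_ring_prod mpoly_ring_Var)+
  also have "\<dots> \<longleftrightarrow> (\<forall>A. A \<subseteq> {1..n} \<and> card A = n - z \<longrightarrow> (\<Prod>i\<in>A. x i) = 0)"
    by simp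
  also have "\<dots> \<longleftrightarrow> \<not> (\<exists>A. A \<subseteq> ?S \<and> card A = n - z)"
  proof -
    have eq: "A \<subseteq> ?S \<longleftrightarrow> A \<subseteq> {1..n} \<and> (\<Prod>i\<in>A. x i) \<noteq> 0" for A
    proof (cases "A \<subseteq> {1..n}")
      case True
      hence "finite A" by (rule finite_subset) simp
      thus ?thesis using True by auto
    qed auto
    show ?thesis unfolding eq by blast
  qed
  also have "(\<exists>A. A \<subseteq> ?S \<and> card A = n - z) \<longleftrightarrow> n - z \<le> card ?S"
  proof
    assume "n - z \<le> card ?S"
    then obtain A where "A \<subseteq> ?S" "card A = n - z" by (rule obtain_subset_with_card_n)
    thus "\<exists>A. A \<subseteq> ?S \<and> card A = n - z" by blast
  next
    assume "\<exists>A. A \<subseteq> ?S \<and> card A = n - z"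
    then obtain A where A: "A \<subseteq> ?S" "card A = n - z" by blast
    have "finite ?S" by simp
    thus "n - z \<le> card ?S" using card_mono[OF _ A(1)] A(2) by simp
  qed
  also have "\<not> n - z \<le> card ?S \<longleftrightarrow> num_zeros n x > z"
    using assms num_zeros_le[of n x] unfolding card_support by auto
  finally show ?thesis .
qed

text \<open>Each ideal of the intersection is tested on its generators; the variables outside
  \<open>S\<close> force the support into \<open>S\<close>. Here \<open>S\<close> may still be
  larger than the support.\<close>

lemma vanishing_orbit_specht_ideal_iff:
  fixes x :: "nat \<Rightarrow> 'a::idom"
  assumes "z \<le> n" and \<mu>: "is_partition (n - z) \<mu>"
  shows "(\<forall>p\<in>orbit_specht_ideal r n \<mu> z. insertion id x p = 0) \<longleftrightarrow>
    (\<exists>S\<subseteq>{1..n}. card S = n - z \<and> (\<forall>i\<in>{1..n} - S. x i = 0) \<and>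
       \<not> multiplicity_partition (\<lambda>i. x i ^ r) S \<unlhd>\<^sub>d \<mu>) \<or> num_zeros n x > z"
proof -
  let ?\<S> = "{S. S \<subseteq> {1..n} \<and> card S = n - z}"
  let ?G = "\<lambda>S. Var ` ({1..n} - S) \<union> phi r S ` specht_ideal (n - z) \<mu> :: 'a mpoly set"
  let ?J = "\<lambda>S. genideal (mpoly_ring {1..n}) (?G S)"
  have fin: "finite S" if "S \<in> ?\<S>" for S
    using that finite_subset[of S "{1..n}"] by simp
  have G: "?G S \<subseteq> carrier (mpoly_ring {1..n})" if S: "S \<in> ?\<S>" for S
  proof -
    have "S \<subseteq> {1..n}" "card S = n - z" using S by simp_all
    hence "phi r S p \<in> carrier (mpoly_ring {1..n})" if "p \<in> specht_ideal (n - z) \<mu>" for p :: "'a mpoly"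
      using that specht_ideal_subset[of "n - z" \<mu>] by (intro phi_closed[OF fin[OF S]]) auto
    moreover have "Var i \<in> carrier (mpoly_ring {1..n} :: 'a mpoly ring)" if "i \<in> {1..n} - S" for i
      using that by (intro mpoly_ring_Var) blast
    ultimately show ?thesis by blast
  qed
  have "(\<forall>p\<in>orbit_specht_ideal r n \<mu> z. insertion id x p = 0) \<longleftrightarrow>
      (\<exists>S\<in>?\<S>. \<forall>p\<in>?J S. insertion id x p = 0) \<or> (\<forall>p\<in>ideal_more_zeros n z. insertion id x p = 0)"
    unfolding orbit_specht_ideal_def
  proof (rule vanishing_INT_iff)
    show "ideal (?J S) (mpoly_ring {1..n})" if "S \<in> ?\<S>" for S
      by (rule ring.genideal_ideal[OF ring_mpoly_ring G[OF that]])
    show "ideal (ideal_more_zeros n z :: 'a mpoly set) (mpoly_ring {1..n})"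
      unfolding ideal_more_zeros_def
      by (rule ring.genideal_ideal[OF ring_mpoly_ring]) (blast intro: mpoly_ring_prod mpoly_ring_Var)
    show "finite ?\<S>"
      by (rule finite_subset[of _ "Pow {1..n}"]) auto
  qed
  also have "(\<exists>S\<in>?\<S>. \<forall>p\<in>?J S. insertion id x p = 0) \<longleftrightarrow>
      (\<exists>S\<in>?\<S>. (\<forall>i\<in>{1..n} - S. x i = 0) \<and> \<not> multiplicity_partition (\<lambda>i. x i ^ r) S \<unlhd>\<^sub>d \<mu>)"
  proof (rule bex_cong[OF refl])
    fix S assume S: "S \<in> ?\<S>"
    show "(\<forall>p\<in>?J S. insertion id x p = 0) \<longleftrightarrow>
      (\<forall>i\<in>{1..n} - S. x i = 0) \<and> \<not> multiplicity_partition (\<lambda>i. x i ^ r) S \<unlhd>\<^sub>d \<mu>"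
    proof -
      have "card S = n - z" using S by simp
      hence "(\<forall>p\<in>phi r S ` specht_ideal (n - z) \<mu>. insertion id x p = 0) \<longleftrightarrow>
          \<not> multiplicity_partition (\<lambda>i. x i ^ r) S \<unlhd>\<^sub>d \<mu>"
        using vanishing_phi_specht_ideal_iff[OF fin[OF S], of \<mu> r x] \<mu> by simp
      thus ?thesis
        unfolding vanishing_genideal_iff[OF G[OF S]] by (simp add: ball_Un)
    qed
  qed
  finally show ?thesis
    unfolding vanishing_ideal_more_zeros_iff[OF assms(1)] by (simp only: Bex_def mem_Collect_eq conj_assoc)
qed

theorem corollary3p4:
  fixes r n z :: nat and \<mu> :: "nat list"
  assumes "infinite (UNIV :: 'a::field set)"
    and "\<forall>\<zeta> :: 'a alg_closure. \<zeta> ^ r = 1 \<longrightarrow> \<zeta> \<in> to_ac ` (UNIV :: 'a set)"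
    and "r \<ge> 2"
    and "z \<le> n"
    and "is_partition (n - z) \<mu>"
  shows "zero_locus n (orbit_specht_ideal r n \<mu> z :: 'a mpoly set) =
    {x \<in> affine_space n. num_zeros n x > z} \<union>
    {x \<in> affine_space n. num_zeros n x = z \<and> \<not> orbit_partition r n x \<unlhd>\<^sub>d \<mu>}"
proof -
  have "(\<forall>p\<in>orbit_specht_ideal r n \<mu> z. insertion id x p = 0) \<longleftrightarrow>
      num_zeros n x > z \<or> num_zeros n x = z \<and> \<not> orbit_partition r n x \<unlhd>\<^sub>d \<mu>"
    for x :: "nat \<Rightarrow> 'a"
  proof (cases "num_zeros n x > z")
    case False
    let ?S = "{i \<in> {1..n}. x i \<noteq> 0}"
    \<comment> \<open>\<open>S\<close> contains the support, which has at least \<open>n - z\<close>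
      elements because \<open>x\<close> has at most \<open>z\<close> zeros; equality follows by
      size.\<close>
    have support: "num_zeros n x = z \<and> S = ?S"
      if S: "S \<subseteq> {1..n}" "card S = n - z" "\<forall>i\<in>{1..n} - S. x i = 0" for S
    proof -
      have sub: "?S \<subseteq> S" and "finite S" using S by (auto intro: finite_subset)
      moreover have "card S \<le> card ?S" using S(2) False unfolding card_support by simp
      ultimately have eq: "?S = S" by (intro card_seteq)
      hence "n - num_zeros n x = n - z" using S(2) card_support[of n x] by simp
      thus ?thesis using eq assms(4) num_zeros_le[of n x] by auto
    qed
    have "(\<exists>S\<subseteq>{1..n}. card S = n - z \<and> (\<forall>i\<in>{1..n} - S. x i = 0) \<and>
         \<not> multiplicity_partition (\<lambda>i. x i ^ r) S \<unlhd>\<^sub>d \<mu>) \<longleftrightarrow>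
        num_zeros n x = z \<and> \<not> multiplicity_partition (\<lambda>i. x i ^ r) ?S \<unlhd>\<^sub>d \<mu>"
      (is "?L \<longleftrightarrow> ?R")
    proof
      assume ?L
      then obtain S where S: "S \<subseteq> {1..n}" "card S = n - z" "\<forall>i\<in>{1..n} - S. x i = 0"
        "\<not> multiplicity_partition (\<lambda>i. x i ^ r) S \<unlhd>\<^sub>d \<mu>" by blast
      show ?R using support[OF S(1-3)] S(4) by simp
    next
      assume ?R
      \<comment> \<open>The support itself is the witness.\<close>
      thus ?L using card_support[of n x] by (intro exI[of _ ?S]) auto
    qed
    thus ?thesis
      using False
      unfolding vanishing_orbit_specht_ideal_iff[OF assms(4,5)] orbit_partition_eq_multiplicity_partition
      by blast
  \<comment> \<open>With more than \<open>z\<close> zeros both sides are true.\<close>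
  qed (simp add: vanishing_orbit_specht_ideal_iff[OF assms(4,5)])
  thus ?thesis by (auto simp: zero_locus_def)
qed

end
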